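(* Let $G=(V,E)$ be a graph with finitely many vertices and edges, let $\mathscr{H}$ be the set of all subgraphs of $G$, and let $w:\mathscr{H}\to\mathbb{R}_+$ be a weight function. Define $\underline{w}:\mathscr{H}\to\mathbb{R}_+$ by $$\underline{w}(H):=\max\{\,w(H') \mid H'\in\mathscr{H},\ H'\subseteq H\,\}\qquad (H\in\mathscr{H}).$$ Then $\underline{w}$ is the smallest monotone (increasing) majorant of $w$; that is, $\underline{w}$ is monotone increasing, $w(H)\le\underline{w}(H)$ for all $H\in\mathscr{H}$, and every monotone increasing function $v:\mathscr{H}\to\mathbb{R}_+$ with $w(H)\le v(H)$ for all $H\in\mathscr{H}$ satisfies $\underline{w}(H)\le v(H)$ for all $H\in\mathscr{H}$.
   Context: $\mathbb{R}_+$ denotes the set of non-negative real numbers. For subgraphs, $H'\subseteq H$ means that $H'$ is a subgraph of $H$. A weighted graph $G(V,E,w)$ is a graph $G=(V,E)$ together with a function $w:\mathscr{H}\to\mathbb{R}_+$ on the set $\mathscr{H}$ of all subgraphs of $G$. The function $w$ (equivalently, the weighted graph) is called monotone (increasing) if $w(H_1)\le w(H_2)$ for all $H_1,H_2\in\mathscr{H}$ with $H_1\subset H_2$. A majorant of $w$ with a property $P$ is a function $v:\mathscr{H}\to\mathbb{R}_+$ having property $P$ with $w(H)\le v(H)$ for all $H\in\mathscr{H}$; the smallest such majorant is the one that is pointwise less than or equal to all others. *)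

theory Defs
  imports Complex_Main "HOL-Library.FuncSet"
begin

text \<open>
  Graphs are undirected; loops and parallel edges are allowed. Simple graphs are the case where
  edges are two-element vertex sets and \<open>ends\<close> is the identity.
\<close>

record ('v, 'e) ugraph =
  verts :: "'v set"
  edges :: "'e set"
  ends :: "'e \<Rightarrow> 'v set"

definition wf_ugraph :: "('v, 'e) ugraph \<Rightarrow> bool" where
  "wf_ugraph G \<longleftrightarrow> (\<forall>e \<in> edges G. ends G e \<subseteq> verts G \<and> card (ends G e) \<in> {1, 2})"

text \<open>
  A subgraph carries the same total function \<open>ends\<close>, including its irrelevant values outside
  the edge set. So a subgraph is determined by its vertices and edges, and a finite graph has
  only finitely many subgraphs. The null graph counts as a subgraph.
\<close>

definition subgraph :: "('v, 'e) ugraph \<Rightarrow> ('v, 'e) ugraph \<Rightarrow> bool" where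
  "subgraph H G \<longleftrightarrow> wf_ugraph H \<and> wf_ugraph G \<and>
     verts H \<subseteq> verts G \<and> edges H \<subseteq> edges G \<and> ends H = ends G"

definition subgraphs :: "('v, 'e) ugraph \<Rightarrow> ('v, 'e) ugraph set" where
  "subgraphs G = {H. subgraph H G}"

text \<open>
  Functions on \<open>subgraphs G\<close> are total functions of which only the values on \<open>subgraphs G\<close> matter.
\<close>

definition weight_function :: "('v, 'e) ugraph \<Rightarrow> (('v, 'e) ugraph \<Rightarrow> real) \<Rightarrow> bool" where
  "weight_function G w \<longleftrightarrow> w \<in> subgraphs G \<rightarrow> {0..}"

definition monotone_weight :: "('v, 'e) ugraph \<Rightarrow> (('v, 'e) ugraph \<Rightarrow> real) \<Rightarrow> bool" where
  "monotone_weight G w \<longleftrightarrow> monotone_on (subgraphs G) subgraph (\<le>) w"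

definition majorant ::
  "('v, 'e) ugraph \<Rightarrow> ((('v, 'e) ugraph \<Rightarrow> real) \<Rightarrow> bool) \<Rightarrow>
   (('v, 'e) ugraph \<Rightarrow> real) \<Rightarrow> (('v, 'e) ugraph \<Rightarrow> real) \<Rightarrow> bool" where
  "majorant G P w v \<longleftrightarrow> weight_function G v \<and> P v \<and> (\<forall>H \<in> subgraphs G. w H \<le> v H)"

definition smallest_majorant ::
  "('v, 'e) ugraph \<Rightarrow> ((('v, 'e) ugraph \<Rightarrow> real) \<Rightarrow> bool) \<Rightarrow>
   (('v, 'e) ugraph \<Rightarrow> real) \<Rightarrow> (('v, 'e) ugraph \<Rightarrow> real) \<Rightarrow> bool" where
  "smallest_majorant G P w u \<longleftrightarrow> majorant G P w u \<and>
     (\<forall>v. majorant G P w v \<longrightarrow> (\<forall>H \<in> subgraphs G. u H \<le> v H))"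

definition lower_max ::
  "('v, 'e) ugraph \<Rightarrow> (('v, 'e) ugraph \<Rightarrow> real) \<Rightarrow> ('v, 'e) ugraph \<Rightarrow> real" where
  "lower_max G w H = Max {w H' | H'. H' \<in> subgraphs G \<and> subgraph H' H}"

end

theory Submission
  imports Defs
begin

text \<open>A finite graph has finitely many subgraphs (\<open>finite_subgraphs\<close>), so the
  maximum in \<open>lower_max\<close> runs over a finite set, nonempty because H is a subgraph of
  itself. Hence it bounds each of its candidates (\<open>lower_max_ge\<close>) and is the weight of
  one of them (\<open>lower_max_attained\<close>). Reflexivity of the subgraph relation gives the
  majorant property, and transitivity gives monotonicity, since enlarging H only adds candidates.
  For leastness, let H' attain the maximum at H: a monotone majorant v satisfies w H' \<le> v H'
  \<le> v H.\<close>

lemma subgraph_refl: "subgraph G G" if "wf_ugraph G"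
  using that by (simp add: subgraph_def)

lemma subgraph_trans: "subgraph H K" if "subgraph H I" "subgraph I K"
  using that by (auto simp: subgraph_def)

text \<open>With \<open>ends\<close> fixed by G, a subgraph is encoded by a pair of subsets of two
  finite sets. Some pairs encode ill-formed records, so only an inclusion is shown.\<close>

lemma finite_subgraphs:
  assumes "finite (verts G)" and "finite (edges G)"
  shows "finite (subgraphs G)"
proof (rule finite_subset)
  show "subgraphs G \<subseteq> (\<lambda>(V, E). \<lparr>verts = V, edges = E, ends = ends G\<rparr>) ` (Pow (verts G) \<times> Pow (edges G))"
  proof
    fix H assume "H \<in> subgraphs G"
    then have "H = \<lparr>verts = verts H, edges = edges H, ends = ends G\<rparr>"
      and "verts H \<subseteq> verts G" and "edges H \<subseteq> edges G"
      by (auto simp: subgraphs_def subgraph_def)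
    then show "H \<in> (\<lambda>(V, E). \<lparr>verts = V, edges = E, ends = ends G\<rparr>) ` (Pow (verts G) \<times> Pow (edges G))"
      by (intro image_eqI[where x = "(verts H, edges H)"]) auto
  qed
qed (use assms in simp)

lemma lower_max_ge:
  assumes "finite (subgraphs G)" and "H' \<in> subgraphs G" and "subgraph H' H"
  shows "w H' \<le> lower_max G w H"
  unfolding lower_max_def using assms by (intro Max_ge) auto

text \<open>Trades the maximum for a concrete maximizer H', to which monotonicity and majorant
  arguments can be applied. H itself shows that there is a candidate.\<close>

lemma lower_max_attained:
  assumes "finite (subgraphs G)" and "H \<in> subgraphs G"
  obtains H' where "H' \<in> subgraphs G" and "subgraph H' H" and "lower_max G w H = w H'"
proof -
  have "subgraph H H"
    using assms(2) by (auto simp: subgraphs_def subgraph_def)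
  then have "lower_max G w H \<in> {w H' | H'. H' \<in> subgraphs G \<and> subgraph H' H}"
    unfolding lower_max_def using assms by (intro Max_in) auto
  then show thesis using that by blast
qed

theorem proposition1p3:
  fixes G :: "('v, 'e) ugraph" and w :: "('v, 'e) ugraph \<Rightarrow> real"
  assumes "wf_ugraph G" and "finite (verts G)" and "finite (edges G)"
    and "weight_function G w"
  shows "smallest_majorant G (monotone_weight G) w (lower_max G w)"
proof -
  have fin: "finite (subgraphs G)"
    using assms(2,3) by (rule finite_subgraphs)
  have above: "w H \<le> lower_max G w H" if "H \<in> subgraphs G" for H
  proof (rule lower_max_ge[OF fin that])
    show "subgraph H H"
      using that by (intro subgraph_refl) (simp add: subgraphs_def subgraph_def)
  qed
  have nonneg: "weight_function G (lower_max G w)"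
    unfolding weight_function_def
  proof
    fix H assume H: "H \<in> subgraphs G"
    have "0 \<le> w H"
      using assms(4) H by (auto simp: weight_function_def)
    also have "w H \<le> lower_max G w H"
      using H by (rule above)
    finally show "lower_max G w H \<in> {0..}" by simp
  qed
  have mono: "monotone_weight G (lower_max G w)"
    unfolding monotone_weight_def
  proof (rule monotone_onI)
    fix H K assume H: "H \<in> subgraphs G" and HK: "subgraph H K"
    obtain H' where H': "H' \<in> subgraphs G" "subgraph H' H" "lower_max G w H = w H'"
      using lower_max_attained[OF fin H] .
    \<comment> \<open>The maximizer for H is, by transitivity, also a candidate for K.\<close>
    have "w H' \<le> lower_max G w K"
      using fin H'(1) subgraph_trans[OF H'(2) HK] by (rule lower_max_ge)
    with H'(3) show "lower_max G w H \<le> lower_max G w K" by simp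
  qed
  have least: "lower_max G w H \<le> v H"
    if v: "majorant G (monotone_weight G) w v" and H: "H \<in> subgraphs G" for v H
  proof -
    obtain H' where H': "H' \<in> subgraphs G" "subgraph H' H" "lower_max G w H = w H'"
      using lower_max_attained[OF fin H] .
    have "w H' \<le> v H'"
      using v H' by (simp add: majorant_def)
    \<comment> \<open>Here the monotonicity of v is used, along the inclusion of H' in H.\<close>
    also have "v H' \<le> v H"
      using v H H' by (simp add: majorant_def monotone_weight_def monotone_on_def)
    finally show ?thesis using H' by simp
  qed
  show ?thesis
    unfolding smallest_majorant_def
  proof (intro conjI allI impI ballI)
    show "majorant G (monotone_weight G) w (lower_max G w)"
      using above nonneg mono by (simp add: majorant_def)
  qed (rule least)
qed

end
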